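(* Let $C$ be a binary self-dual code of length $n$ that is not equivalent (under permutation of coordinates) to $\mathbf{z}^{n/2}$, the direct sum of $n/2$ copies of the double repetition code $\mathbf{z}=\{(0,0),(1,1)\}\subset F^2$. Then the shadow of $C$ contains words of weight $<n/2$; consequently the minimal weight of the shadow of $C$ is at most $(n-8)/2$.
   Context: Let $F=\mathbb{Z}/2\mathbb{Z}$. The (Hamming) weight $\mathrm{wt}(w)$ of $w\in F^n$ is the number of nonzero coordinates of $w$. A binary self-dual code of length $n$ is a linear subspace $C\subset F^n$ which equals its own annihilator under the pairing $(v,w)=\sum_{j=1}^n v_jw_j\in F$; then $n$ is even and every word of $C$ has even weight. The map $C\to F$, $c\mapsto \tfrac12\mathrm{wt}(c) \bmod 2$, is linear. The shadow of $C$ is the coset $C'$ of $C$ in $F^n$ consisting of all $c'\in F^n$ such that $\tfrac12\mathrm{wt}(c)\equiv (c,c')\pmod 2$ for all $c\in C$. The minimal weight of the shadow is the smallest weight of a word in $C'$. *)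

theory Defs
  imports
    "HOL-Library.Z2"
    "HOL-Combinatorics.Permutations"
    "Jordan_Normal_Form.VS_Connect"
begin

text \<open>
  Words of length n over Z/2Z are elements of \<open>carrier_vec n\<close> with entries in the
  two-element field \<^typ>\<open>bit\<close>; codes are sets of such words, their length n being
  passed as a separate parameter. The pairing is the library's \<open>scalar_prod\<close>.
\<close>

definition wt :: "bit vec \<Rightarrow> nat" where
  "wt w = card {i. i < dim_vec w \<and> w $ i \<noteq> 0}"

definition annihilator :: "nat \<Rightarrow> bit vec set \<Rightarrow> bit vec set" where
  "annihilator n C = {w \<in> carrier_vec n. \<forall>v\<in>C. v \<bullet> w = 0}"

definition linear_code :: "nat \<Rightarrow> bit vec set \<Rightarrow> bool" where
  "linear_code n C \<longleftrightarrow>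
     VectorSpace.subspace (class_ring :: bit ring) C (module_vec TYPE(bit) n)"

definition self_dual_code :: "nat \<Rightarrow> bit vec set \<Rightarrow> bool" where
  "self_dual_code n C \<longleftrightarrow> linear_code n C \<and> C = annihilator n C"

text \<open>
  The truncating division below is exact whenever C is self-dual, since all weights
  in C are then even.
\<close>

definition shadow :: "nat \<Rightarrow> bit vec set \<Rightarrow> bit vec set" where
  "shadow n C = {c' \<in> carrier_vec n. \<forall>c\<in>C. (of_nat (wt c div 2) :: bit) = c \<bullet> c'}"

definition min_weight :: "bit vec set \<Rightarrow> nat" where
  "min_weight S = Min (wt ` S)"

definition permute_word :: "nat \<Rightarrow> (nat \<Rightarrow> nat) \<Rightarrow> bit vec \<Rightarrow> bit vec" where
  "permute_word n p w = vec n (\<lambda>i. w $ p i)"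

definition equivalent_codes :: "nat \<Rightarrow> bit vec set \<Rightarrow> bit vec set \<Rightarrow> bool" where
  "equivalent_codes n C D \<longleftrightarrow> (\<exists>p. p permutes {..<n} \<and> D = permute_word n p ` C)"

definition direct_sum_code :: "bit vec set \<Rightarrow> bit vec set \<Rightarrow> bit vec set" where
  "direct_sum_code C D = {v @\<^sub>v w | v w. v \<in> C \<and> w \<in> D}"

definition double_repetition_code :: "bit vec set" where
  "double_repetition_code = {vec_of_list [0, 0], vec_of_list [1, 1]}"

primrec code_power :: "bit vec set \<Rightarrow> nat \<Rightarrow> bit vec set" where
  "code_power C 0 = {0\<^sub>v 0}"
| "code_power C (Suc k) = direct_sum_code C (code_power C k)"

end

theory Submission
  imports Defs
begin

text \<open>
  Write \<open>\<i>\<close> for the imaginary unit. The function \<open>w \<mapsto> \<i> ^ wt w\<close> is quadratic: on a sum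
  \<open>v + w\<close> it is the product of its values times the sign of \<open>v \<bullet> w\<close>. For self-dual \<open>C\<close>
  this turns membership of \<open>v\<close> in the shadow into the condition that \<open>\<i> ^ wt\<close> is constant
  on the coset \<open>v + C\<close>; on any other coset \<open>\<i> ^ wt\<close> is a nontrivial character up to a
  factor, so it sums to zero. Adding up all cosets, the Gauss sum
  \<open>(1 + \<i>) ^ n = (2 * \<i>) ^ (n div 2)\<close> of all words equals the sum over the shadow alone
  (\<open>shadow_sum\<close>). Hence the shadow is nonempty, and comparing absolute values and
  arguments shows that its weights are all congruent to \<open>n div 2\<close> modulo 4
  (\<open>shadow_wt_mod_4\<close>).

  The all-ones word lies in \<open>C\<close>, so the shadow is closed under complements, which
  exchange the weights \<open>k\<close> and \<open>n - k\<close>. If no shadow word has weight below \<open>n / 2\<close>, then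
  all have weight exactly \<open>n / 2\<close>, that is, the signs of the coordinates of each shadow
  word sum to zero. Multiplying by the sign at \<open>i\<close> and summing over the shadow, the term
  belonging to \<open>i\<close> itself is positive, so some other coordinate \<open>j\<close> contributes as well.
  This is possible only if the coordinates \<open>i\<close> and \<open>j\<close> agree throughout \<open>C\<close>, which means
  that \<open>C\<close> contains the word of weight two supported on \<open>i\<close> and \<open>j\<close> (\<open>twin_exists\<close>). Such words
  have disjoint supports by self-orthogonality, so they pair up all the coordinates,
  and \<open>C\<close> is a permuted sum of double repetition codes
  (\<open>equivalent_of_half_weight_shadow\<close>).

  Otherwise some shadow word has weight below \<open>n / 2\<close>, and the congruence modulo 4
  improves this to at most \<open>n / 2 - 4\<close>.
\<close>

section \<open>Signs and weights\<close>

text \<open>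
  Rewriting to bitwise operations would hide the ring structure from the laws for sums
  and products, and rewriting \<open>b \<noteq> 0\<close> to \<open>b = 1\<close> would hide the support of a word, in
  terms of which weights are defined.
\<close>
declare add_bit_eq_xor [simp del] mult_bit_eq_and [simp del] bit_not_zero_iff [simp del]

lemma bit_add_self [simp]: "a + a = (0 :: bit)"
  by (cases a) simp_all

lemma bit_mult_self [simp]: "a * a = (a :: bit)"
  by (cases a) simp_all

lemma UNIV_bit: "(UNIV :: bit set) = {0, 1}"
  by (auto intro: bit.exhaust)

definition bit_sign :: "bit \<Rightarrow> complex" where
  "bit_sign b = (if b = 0 then 1 else -1)"

lemma bit_sign_0 [simp]: "bit_sign 0 = 1"
  by (simp add: bit_sign_def)

lemma bit_sign_add: "bit_sign (a + b) = bit_sign a * bit_sign b"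
  by (cases a; cases b) (auto simp: bit_sign_def)

lemma bit_sign_eq_1_iff: "bit_sign b = 1 \<longleftrightarrow> b = 0"
  by (simp add: bit_sign_def)

lemma bit_sign_sum: "finite A \<Longrightarrow> bit_sign (\<Sum>i\<in>A. f i) = (\<Prod>i\<in>A. bit_sign (f i))"
  by (induction A rule: finite_induct) (auto simp: bit_sign_add)

lemma bit_sign_of_nat: "bit_sign (of_nat k) = (-1) ^ k"
  by (induction k) (auto simp: bit_sign_add, simp_all add: bit_sign_def)

definition bit_phase :: "bit \<Rightarrow> complex" where
  "bit_phase b = (if b = 0 then 1 else \<i>)"

lemma bit_phase_add: "bit_phase (a + b) = bit_phase a * bit_phase b * bit_sign (a * b)"
  by (cases a; cases b) (auto simp: bit_phase_def bit_sign_def)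

lemma i_power_wt:
  assumes "w \<in> carrier_vec n"
  shows "\<i> ^ wt w = (\<Prod>i<n. bit_phase (w $ i))"
proof -
  have "(\<Prod>i<n. bit_phase (w $ i)) = (\<Prod>i\<in>{i. i < n \<and> w $ i \<noteq> 0}. \<i>)"
    by (rule prod.mono_neutral_cong_right) (auto simp: bit_phase_def)
  with assms show ?thesis by (simp add: wt_def)
qed

lemma sum_bit_sign:
  assumes "w \<in> carrier_vec n"
  shows "(\<Sum>i<n. bit_sign (w $ i)) = of_nat n - 2 * of_nat (wt w)"
proof -
  have "(\<Sum>i<n. bit_sign (w $ i)) = (\<Sum>i<n. 1 - 2 * (if w $ i \<noteq> 0 then 1 else 0))"
    by (rule sum.cong) (auto simp: bit_sign_def)
  also have "\<dots> = of_nat n - 2 * (\<Sum>i<n. if w $ i \<noteq> 0 then 1 else 0)"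
    by (simp add: sum_subtractf sum_distrib_left)
  also have "(\<Sum>i<n. if w $ i \<noteq> 0 then 1 else 0) = (of_nat (wt w) :: complex)"
    using assms by (simp add: wt_def sum.If_cases Int_def)
  finally show ?thesis .
qed

text \<open>
  In \<open>wt v + wt w\<close> the coordinates where both words are 1 count twice, in \<open>wt (v + w)\<close>
  not at all; each of them costs a factor \<open>\<i> * \<i> = -1\<close>, and together these are the sign of the
  pairing.
\<close>
lemma i_power_wt_add:
  assumes "v \<in> carrier_vec n" "w \<in> carrier_vec n"
  shows "\<i> ^ wt (v + w) = \<i> ^ wt v * \<i> ^ wt w * bit_sign (v \<bullet> w)"
proof -
  have "\<i> ^ wt (v + w) = (\<Prod>i<n. bit_phase (v $ i + w $ i))"
    using assms by (subst i_power_wt[of _ n]) auto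
  also have "\<dots> = (\<Prod>i<n. bit_phase (v $ i)) * (\<Prod>i<n. bit_phase (w $ i))
      * (\<Prod>i<n. bit_sign (v $ i * w $ i))"
    by (simp add: bit_phase_add prod.distrib)
  also have "(\<Prod>i<n. bit_sign (v $ i * w $ i)) = bit_sign (v \<bullet> w)"
    using assms by (simp add: scalar_prod_def bit_sign_sum lessThan_atLeast0)
  finally show ?thesis using assms by (simp add: i_power_wt)
qed

text \<open>
  Identifying words with functions on the index set makes the distributive law
  applicable to sums over all words.
\<close>
lemma bij_betw_vec_PiE: "bij_betw (vec n) ({..<n} \<rightarrow>\<^sub>E (UNIV :: 'a set)) (carrier_vec n)"
proof (rule bij_betwI[where g = "\<lambda>v. restrict (($) v) {..<n}"])
  show "vec n (restrict (($) v) {..<n}) = v" if "v \<in> carrier_vec n" for v :: "'a vec"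
    using that by (intro eq_vecI) auto
  show "restrict (($) (vec n g)) {..<n} = g" if "g \<in> {..<n} \<rightarrow>\<^sub>E UNIV" for g :: "nat \<Rightarrow> 'a"
    using that by (intro ext) (auto simp: PiE_def extensional_def)
qed auto

lemma finite_carrier_bit_vec: "finite (carrier_vec n :: bit vec set)"
proof -
  have "finite ({..<n} \<rightarrow>\<^sub>E (UNIV :: bit set))"
    by (intro finite_PiE) (auto simp: UNIV_bit)
  then show ?thesis using bij_betw_finite[OF bij_betw_vec_PiE] by blast
qed

lemma sum_i_power_wt: "(\<Sum>v\<in>carrier_vec n. \<i> ^ wt v) = (1 + \<i>) ^ n"
proof -
  have "(1 + \<i>) ^ n = (\<Prod>i<n. \<Sum>b\<in>UNIV. bit_phase b)"
    by (simp add: UNIV_bit bit_phase_def)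
  also have "\<dots> = (\<Sum>g\<in>{..<n} \<rightarrow>\<^sub>E UNIV. \<Prod>i<n. bit_phase (g i))"
    by (rule prod_sum_PiE) (auto simp: UNIV_bit)
  also have "\<dots> = (\<Sum>g\<in>{..<n} \<rightarrow>\<^sub>E UNIV. \<i> ^ wt (vec n g))"
    by (simp add: i_power_wt[of _ n])
  also have "\<dots> = (\<Sum>v\<in>carrier_vec n. \<i> ^ wt v)"
    by (rule sum.reindex_bij_betw[OF bij_betw_vec_PiE])
  finally show ?thesis by simp
qed

lemma i_power_eq_iff: "\<i> ^ a = \<i> ^ b \<longleftrightarrow> a mod 4 = b mod 4"
proof -
  have red: "\<i> ^ a = \<i> ^ (a mod 4)" for a
  proof -
    have "\<i> ^ (4 * (a div 4) + a mod 4) = \<i> ^ (a mod 4)"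
      by (simp only: power_add power_mult) simp
    then show ?thesis by simp
  qed
  have "x = y" if "\<i> ^ x = \<i> ^ y" "x < 4" "y < 4" for x y :: nat
    using that by (auto simp: numeral_eq_Suc less_Suc_eq complex_eq_iff)
  then show ?thesis
    by (metis red mod_less_divisor zero_less_numeral)
qed

lemma i_power_even: "even k \<Longrightarrow> \<i> ^ k = bit_sign (of_nat (k div 2))"
  by (auto elim!: evenE simp: power_mult bit_sign_of_nat)

lemma bit_vec_add_self:
  fixes v w :: "bit vec"
  assumes "v \<in> carrier_vec n" "w \<in> carrier_vec n"
  shows "v + (v + w) = w"
  using assms by (intro eq_vecI) (auto simp: add.assoc[symmetric])

lemma bit_vec_scalar_prod_self: "(w :: bit vec) \<bullet> w = of_nat (wt w)"
proof -
  have "w \<bullet> w = (\<Sum>i<dim_vec w. if w $ i \<noteq> 0 then 1 else 0)"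
    unfolding scalar_prod_def lessThan_atLeast0
    by (rule sum.cong) (auto simp: bit_not_zero_iff)
  also have "\<dots> = of_nat (wt w)"
    by (simp add: wt_def sum.If_cases Int_def)
  finally show ?thesis .
qed

lemma of_nat_bit_eq_0_iff_even: "(of_nat k :: bit) = 0 \<longleftrightarrow> even k"
  by (induction k) (auto simp: bit_not_zero_iff)

lemma scalar_prod_ones:
  assumes "(w :: bit vec) \<in> carrier_vec n"
  shows "w \<bullet> vec n (\<lambda>_. 1) = w \<bullet> w"
  unfolding scalar_prod_def using assms by (auto intro!: sum.cong)

lemma wt_complement:
  assumes "w \<in> carrier_vec n"
  shows "wt (vec n (\<lambda>_. 1) + w) = n - wt w" "wt w \<le> n"
proof -
  let ?A = "{i. i < n \<and> w $ i \<noteq> 0}"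
  have "{i. i < n \<and> (vec n (\<lambda>_. 1) + w) $ i \<noteq> 0} = {..<n} - ?A"
    using assms by (auto simp: bit_not_zero_iff)
  moreover have "card ({..<n} - ?A) = n - card ?A"
    by (subst card_Diff_subset) auto
  ultimately show "wt (vec n (\<lambda>_. 1) + w) = n - wt w"
    using assms by (simp add: wt_def)
  have "card ?A \<le> card {..<n}" by (rule card_mono) auto
  then show "wt w \<le> n" using assms by (simp add: wt_def)
qed

section \<open>The shadow of a self-dual code\<close>

lemma shadow_carrier: "s \<in> shadow n C \<Longrightarrow> s \<in> carrier_vec n"
  by (simp add: shadow_def)

lemma shadow_finite: "finite (shadow n C)"
  using finite_subset[OF _ finite_carrier_bit_vec] shadow_carrier by blast

lemma scalar_prod_unit_sum:
  assumes "(c :: bit vec) \<in> carrier_vec n" "i < n" "j < n"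
  shows "c \<bullet> (unit_vec n i + unit_vec n j) = c $ i + c $ j"
  using assms by (subst scalar_prod_add_distrib[of _ n]) (simp_all add: scalar_prod_right_unit)

context
  fixes n :: nat and C :: "bit vec set"
  assumes self_dual: "self_dual_code n C"
begin

lemma mem_code_iff: "w \<in> C \<longleftrightarrow> w \<in> carrier_vec n \<and> (\<forall>v\<in>C. v \<bullet> w = 0)"
proof -
  have "C = annihilator n C" using self_dual by (simp add: self_dual_code_def)
  then have "w \<in> C \<longleftrightarrow> w \<in> annihilator n C" by (rule arg_cong)
  then show ?thesis by (simp add: annihilator_def)
qed

lemma code_carrier: "c \<in> C \<Longrightarrow> c \<in> carrier_vec n"
  using mem_code_iff by blast

lemma code_orthogonal: "c \<in> C \<Longrightarrow> d \<in> C \<Longrightarrow> c \<bullet> d = 0"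
  using mem_code_iff[of d] by blast

lemma code_finite: "finite C"
  using finite_subset[OF _ finite_carrier_bit_vec] code_carrier by blast

lemma code_zero: "0\<^sub>v n \<in> C"
  by (subst mem_code_iff) (auto simp: code_carrier)

lemma code_add: "c \<in> C \<Longrightarrow> d \<in> C \<Longrightarrow> c + d \<in> C"
  by (subst mem_code_iff)
    (auto simp: code_carrier code_orthogonal scalar_prod_add_distrib[of _ n])

lemma code_even: "c \<in> C \<Longrightarrow> even (wt c)"
  using code_orthogonal[of c c] by (simp add: bit_vec_scalar_prod_self of_nat_bit_eq_0_iff_even)

lemma code_ones: "vec n (\<lambda>_. 1) \<in> C"
proof (subst mem_code_iff, safe)
  show "c \<bullet> vec n (\<lambda>_. 1) = 0" if "c \<in> C" for c
    using that by (subst scalar_prod_ones) (auto simp: code_carrier code_orthogonal)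
qed simp

lemma length_even: "even n"
proof -
  have "{i. i < n \<and> vec n (\<lambda>_. 1 :: bit) $ i \<noteq> 0} = {..<n}" by auto
  then show ?thesis using code_even[OF code_ones] by (simp add: wt_def)
qed

lemma translate_bij:
  assumes "c \<in> C" "\<And>x. x \<in> X \<Longrightarrow> x \<in> carrier_vec n \<and> c + x \<in> X"
  shows "bij_betw (\<lambda>x. c + x) X X"
  by (rule bij_betwI[where g = "\<lambda>x. c + x"])
    (use assms bit_vec_add_self[OF code_carrier[OF assms(1)]] in auto)

text \<open>
  Orthogonality of characters, for functions that translation by a single codeword
  multiplies by a nontrivial constant.
\<close>
lemma sum_vanishes_of_translate:
  fixes f :: "bit vec \<Rightarrow> complex"
  assumes c: "c \<in> C" and X: "\<And>x. x \<in> X \<Longrightarrow> x \<in> carrier_vec n \<and> c + x \<in> X"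
    and f: "\<And>x. x \<in> X \<Longrightarrow> f (c + x) = u * f x" and "u \<noteq> 1"
  shows "sum f X = 0"
proof -
  have "sum f X = (\<Sum>x\<in>X. f (c + x))"
    by (rule sum.reindex_bij_betw[OF translate_bij[OF c X], symmetric])
  also have "\<dots> = u * sum f X" by (simp add: f sum_distrib_left)
  finally show ?thesis using \<open>u \<noteq> 1\<close> by (metis mult_cancel_right1)
qed

text \<open>
  For a codeword \<open>c\<close>, the number \<open>\<i> ^ wt c\<close> is the sign of \<open>wt c div 2\<close>. The quadratic law
  thus compares exactly the two linear functionals that the definition of the shadow
  equates.
\<close>
lemma mem_shadow_iff:
  assumes "v \<in> carrier_vec n"
  shows "v \<in> shadow n C \<longleftrightarrow> (\<forall>c\<in>C. \<i> ^ wt (c + v) = \<i> ^ wt v)"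
proof -
  have "of_nat (wt c div 2) = c \<bullet> v \<longleftrightarrow> \<i> ^ wt (c + v) = \<i> ^ wt v" if "c \<in> C" for c
  proof -
    have "\<i> ^ wt (c + v) = \<i> ^ wt v \<longleftrightarrow> \<i> ^ wt c * bit_sign (c \<bullet> v) = 1"
      using assms code_carrier[OF that] by (auto simp: i_power_wt_add)
    also have "\<dots> \<longleftrightarrow> bit_sign (of_nat (wt c div 2) + c \<bullet> v) = 1"
      unfolding bit_sign_add i_power_even[OF code_even[OF that]] ..
    also have "\<dots> \<longleftrightarrow> of_nat (wt c div 2) = c \<bullet> v"
      by (cases "c \<bullet> v"; cases "of_nat (wt c div 2) :: bit") (auto simp: bit_sign_def)
    finally show ?thesis by blast
  qed
  then show ?thesis using assms by (auto simp: shadow_def)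
qed

text \<open>
  On the coset of \<open>v\<close>, the function \<open>\<i> ^ wt\<close> is \<open>\<i> ^ wt v\<close> times a character of \<open>C\<close>, because
  codewords are orthogonal to one another. The character is trivial exactly for \<open>v\<close> in
  the shadow.
\<close>
lemma coset_sum:
  assumes v: "v \<in> carrier_vec n"
  shows "(\<Sum>c\<in>C. \<i> ^ wt (c + v)) = (if v \<in> shadow n C then of_nat (card C) * \<i> ^ wt v else 0)"
proof (cases "v \<in> shadow n C")
  case True
  then show ?thesis using v by (simp add: mem_shadow_iff)
next
  case False
  then obtain d where d: "d \<in> C" "\<i> ^ wt (d + v) \<noteq> \<i> ^ wt v"
    using v by (auto simp: mem_shadow_iff)
  have "(\<Sum>c\<in>C. \<i> ^ wt (c + v)) = 0"
  proof (rule sum_vanishes_of_translate[OF d(1)])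
    show "c \<in> carrier_vec n \<and> d + c \<in> C" if "c \<in> C" for c
      using that d by (simp add: code_carrier code_add)
    show "\<i> ^ wt (d + c + v) = (\<i> ^ wt d * bit_sign (d \<bullet> v)) * \<i> ^ wt (c + v)" if "c \<in> C" for c
    proof -
      have "d + c + v = d + (c + v)"
        using d that v by (intro assoc_add_vec) (auto intro: code_carrier)
      then show ?thesis
        using d that v code_orthogonal[of d c]
        by (simp add: i_power_wt_add[of _ n] code_carrier scalar_prod_add_distrib[of _ n])
    qed
    show "\<i> ^ wt d * bit_sign (d \<bullet> v) \<noteq> 1"
      using d(2) v code_carrier[OF d(1)] by (auto simp: i_power_wt_add[of _ n])
  qed
  then show ?thesis using False by simp
qed

text \<open>
  Averaging the sum over all words over translations by \<open>C\<close> annihilates every coset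
  other than the shadow.
\<close>
lemma shadow_sum: "(\<Sum>s\<in>shadow n C. \<i> ^ wt s) = (1 + \<i>) ^ n"
proof -
  have "of_nat (card C) * (\<Sum>s\<in>shadow n C. \<i> ^ wt s)
      = (\<Sum>v\<in>carrier_vec n. if v \<in> shadow n C then of_nat (card C) * \<i> ^ wt v else 0)"
    by (subst sum.inter_filter[symmetric])
      (auto simp: finite_carrier_bit_vec sum_distrib_left shadow_carrier intro!: sum.cong)
  also have "\<dots> = (\<Sum>v\<in>carrier_vec n. \<Sum>c\<in>C. \<i> ^ wt (c + v))"
    by (simp add: coset_sum)
  also have "\<dots> = (\<Sum>c\<in>C. \<Sum>v\<in>carrier_vec n. \<i> ^ wt (c + v))"
    by (rule sum.swap)
  also have "\<dots> = (\<Sum>c\<in>C. \<Sum>v\<in>carrier_vec n. \<i> ^ wt v)"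
    by (intro sum.cong refl sum.reindex_bij_betw translate_bij) (auto simp: code_carrier)
  also have "\<dots> = of_nat (card C) * (1 + \<i>) ^ n"
    by (simp add: sum_i_power_wt)
  finally show ?thesis using code_zero code_finite by auto
qed

lemma shadow_nonempty: "shadow n C \<noteq> {}"
proof -
  have "1 + \<i> \<noteq> 0" by (simp add: complex_eq_iff)
  then show ?thesis using shadow_sum by auto
qed

lemma shadow_translate:
  assumes c: "c \<in> C" and s: "s \<in> shadow n C"
  shows "c + s \<in> shadow n C"
proof (subst mem_shadow_iff, safe)
  show sc: "c + s \<in> carrier_vec n" using assms by (simp add: code_carrier shadow_carrier)
  fix d assume d: "d \<in> C"
  have "d + (c + s) = (d + c) + s"
    using assms d by (intro assoc_add_vec[symmetric]) (auto intro: code_carrier shadow_carrier)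
  then show "\<i> ^ wt (d + (c + s)) = \<i> ^ wt (c + s)"
    using assms d code_add[of d c] mem_shadow_iff[of s] shadow_carrier[OF s] by simp
qed

lemma shadow_difference:
  assumes "s \<in> shadow n C" "t \<in> shadow n C"
  shows "s + t \<in> C"
proof (subst mem_code_iff, safe)
  show "s + t \<in> carrier_vec n" using assms by (simp add: shadow_carrier)
  show "c \<bullet> (s + t) = 0" if "c \<in> C" for c
  proof -
    have "c \<bullet> s = c \<bullet> t" using assms that by (auto simp: shadow_def)
    then show ?thesis
      using assms that by (simp add: scalar_prod_add_distrib[of _ n] code_carrier shadow_carrier)
  qed
qed

text \<open>
  Any two shadow words differ by a codeword, so \<open>\<i> ^ wt\<close> is constant on the shadow and
  \<open>shadow_sum\<close> reads \<open>card (shadow n C) * \<i> ^ wt s = (2 * \<i>) ^ (n div 2)\<close>.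
\<close>
lemma shadow_wt_mod_4:
  assumes s: "s \<in> shadow n C"
  shows "wt s mod 4 = (n div 2) mod 4"
proof -
  have "\<i> ^ wt t = \<i> ^ wt s" if t: "t \<in> shadow n C" for t
  proof -
    have "(t + s) + s = t"
      using s t by (intro eq_vecI) (auto dest!: shadow_carrier simp: add.assoc)
    then show ?thesis
      using mem_shadow_iff[OF shadow_carrier[OF s]] s shadow_difference[OF t s] by metis
  qed
  moreover have one_plus_i_square: "(1 + \<i>) ^ 2 = 2 * \<i>"
    by (simp add: power2_eq_square algebra_simps)
  ultimately have "of_nat (card (shadow n C)) * \<i> ^ wt s = (1 + \<i>) ^ n"
    by (simp flip: shadow_sum)
  also have "\<dots> = ((1 + \<i>) ^ 2) ^ (n div 2)"
    using length_even by (simp flip: power_mult)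
  also have "\<dots> = 2 ^ (n div 2) * \<i> ^ (n div 2)"
    using one_plus_i_square by (simp add: power_mult_distrib)
  finally have eq: "of_nat (card (shadow n C)) * \<i> ^ wt s = 2 ^ (n div 2) * \<i> ^ (n div 2)" .
  \<comment> \<open>absolute values determine the size of the shadow, leaving powers of \<open>\<i>\<close> to compare\<close>
  then have "norm (of_nat (card (shadow n C)) * \<i> ^ wt s) = norm (2 ^ (n div 2) * \<i> ^ (n div 2))"
    by simp
  then have "real (card (shadow n C)) = real (2 ^ (n div 2))"
    by (simp add: norm_mult norm_power)
  then have "card (shadow n C) = 2 ^ (n div 2)" by (simp only: of_nat_eq_iff)
  then have "\<i> ^ wt s = \<i> ^ (n div 2)" using eq by simp
  then show ?thesis by (simp add: i_power_eq_iff)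
qed

text \<open>
  The correlation of the coordinates \<open>i\<close> and \<open>j\<close> over the shadow vanishes as soon as some
  codeword \<open>c\<close> has \<open>c $ i \<noteq> c $ j\<close>, because translation by \<open>c\<close> flips the sign. For fixed \<open>i\<close>
  the correlations with all \<open>j\<close> sum to zero when every shadow word is balanced between
  zeros and ones, whereas the correlation of \<open>i\<close> with itself is positive.
\<close>
lemma twin_exists:
  assumes all: "\<And>s. s \<in> shadow n C \<Longrightarrow> 2 * wt s = n" and i: "i < n"
  shows "\<exists>j<n. j \<noteq> i \<and> unit_vec n i + unit_vec n j \<in> C"
proof (rule ccontr)
  assume none: "\<not> ?thesis"
  have zero: "(\<Sum>s\<in>shadow n C. bit_sign (s $ i + s $ j)) = 0" if j: "j < n" "j \<noteq> i" for j
  proof -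
    have "unit_vec n i + unit_vec n j \<notin> C" using none j by blast
    then obtain c where "c \<in> C" "c \<bullet> (unit_vec n i + unit_vec n j) \<noteq> 0"
      using mem_code_iff[of "unit_vec n i + unit_vec n j"] by (metis add_carrier_vec unit_vec_carrier)
    then have c: "c \<in> C" "c $ i + c $ j \<noteq> 0"
      using scalar_prod_unit_sum[of c n i j] code_carrier[of c] i j by simp_all
    show ?thesis
    proof (rule sum_vanishes_of_translate[OF c(1)])
      show "s \<in> carrier_vec n \<and> c + s \<in> shadow n C" if "s \<in> shadow n C" for s
        using that c by (simp add: shadow_carrier shadow_translate)
      show "bit_sign ((c + s) $ i + (c + s) $ j) = bit_sign (c $ i + c $ j) * bit_sign (s $ i + s $ j)"
        if "s \<in> shadow n C" for s
        using shadow_carrier[OF that] i j by (simp add: bit_sign_add)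
      show "bit_sign (c $ i + c $ j) \<noteq> 1" using c(2) by (simp only: bit_sign_eq_1_iff not_False_eq_True)
    qed
  qed
  have "0 = (\<Sum>s\<in>shadow n C. bit_sign (s $ i) * (\<Sum>j<n. bit_sign (s $ j)))"
  proof (rule sum.neutral[symmetric], safe)
    fix s assume s: "s \<in> shadow n C"
    have "of_nat n - 2 * of_nat (wt s) = (0 :: complex)"
      using all[OF s] by (metis diff_self of_nat_mult of_nat_numeral)
    then show "bit_sign (s $ i) * (\<Sum>j<n. bit_sign (s $ j)) = 0"
      using sum_bit_sign[OF shadow_carrier[OF s]] by simp
  qed
  also have "\<dots> = (\<Sum>j<n. \<Sum>s\<in>shadow n C. bit_sign (s $ i + s $ j))"
    by (simp add: sum_distrib_left bit_sign_add sum.swap[of _ "shadow n C"])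
  also have "\<dots> = (\<Sum>j\<in>{i}. \<Sum>s\<in>shadow n C. bit_sign (s $ i + s $ j))"
    by (rule sum.mono_neutral_right) (use i zero in auto)
  also have "\<dots> = of_nat (card (shadow n C))"
    by simp
  finally show False using shadow_nonempty shadow_finite by auto
qed

lemma twin_coords_eq:
  assumes "unit_vec n i + unit_vec n j \<in> C" "c \<in> C" "i < n" "j < n"
  shows "c $ i = c $ j"
proof -
  have "c $ i + c $ j = 0"
    using code_orthogonal[OF assms(2,1)] scalar_prod_unit_sum[of c n i j] assms by (simp add: code_carrier)
  then show ?thesis by (cases "c $ i"; cases "c $ j") auto
qed

text \<open>
  Two words of weight two with supports meeting in exactly one coordinate are not
  orthogonal.
\<close>
lemma twin_unique:
  assumes "unit_vec n i + unit_vec n j \<in> C" "unit_vec n i + unit_vec n k \<in> C"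
    "i < n" "j < n" "k < n" "j \<noteq> i" "k \<noteq> i"
  shows "j = k"
  using twin_coords_eq[OF assms(2,1,3,5)] assms by (auto split: if_splits)

end

section \<open>Sums of double repetition codes\<close>

text \<open>
  Brings a fixed-point-free involution \<open>t\<close> into the standard form that swaps \<open>2 * k\<close> and
  \<open>2 * k + 1\<close>, by splitting off one orbit at a time.
\<close>
lemma involution_enumeration:
  assumes "finite A" "\<And>x. x \<in> A \<Longrightarrow> t x \<in> A \<and> t x \<noteq> x \<and> t (t x) = x"
  shows "\<exists>(m :: nat) f. bij_betw f {..<2 * m} A \<and> (\<forall>k<m. f (2 * k + 1) = t (f (2 * k)))"
  using assms
proof (induction "card A" arbitrary: A rule: less_induct)
  case less
  show ?case
  proof (cases "A = {}")
    case True
    then show ?thesis by (intro exI[of _ 0] exI[of _ "\<lambda>_. undefined"]) (simp add: bij_betw_def)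
  next
    case False
    then obtain x where x: "x \<in> A" by blast
    let ?B = "A - {x, t x}"
    have "card ?B < card A" using x less.prems(1) by (intro psubset_card_mono) auto
    moreover have "t y \<in> ?B \<and> t y \<noteq> y \<and> t (t y) = y" if "y \<in> ?B" for y
      using that less.prems(2) x by (metis DiffD1 DiffD2 DiffI insert_iff singletonD)
    ultimately obtain m :: nat and f where f: "bij_betw f {..<2 * m} ?B"
        "\<And>k. k < m \<Longrightarrow> f (2 * k + 1) = t (f (2 * k))"
      using less.hyps[of ?B] less.prems(1) by auto
    define g where "g = f(2 * m := x, 2 * m + 1 := t x)"
    have "bij_betw g {..<2 * m} ?B"
      using f(1) by (rule bij_betw_cong[THEN iffD1, rotated]) (auto simp: g_def)
    moreover have "bij_betw g {2 * m, 2 * m + 1} {x, t x}"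
      using less.prems(2)[OF x] by (auto simp: g_def bij_betw_def)
    ultimately have "bij_betw g ({..<2 * m} \<union> {2 * m, 2 * m + 1}) (?B \<union> {x, t x})"
      by (rule bij_betw_combine) auto
    moreover have "{..<2 * m} \<union> {2 * m, 2 * m + 1} = {..<2 * Suc m}" by auto
    moreover have "?B \<union> {x, t x} = A" using x less.prems(2) by auto
    moreover have "g (2 * k + 1) = t (g (2 * k))" if "k < Suc m" for k
      using that f(2)[of k] by (cases "k = m") (auto simp: g_def)
    ultimately show ?thesis by (intro exI[of _ "Suc m"] exI[of _ g]) auto
  qed
qed

lemma mem_double_repetition_code:
  "v \<in> double_repetition_code \<longleftrightarrow> v \<in> carrier_vec 2 \<and> v $ 0 = v $ 1"
proof
  assume v: "v \<in> carrier_vec 2 \<and> v $ 0 = v $ 1"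
  have "v = vec_of_list [v $ 0, v $ 0]"
    using v by (intro eq_vecI) (auto simp: numeral_2_eq_2 less_Suc_eq)
  then show "v \<in> double_repetition_code"
    by (cases "v $ 0") (auto simp: double_repetition_code_def)
qed (auto simp: double_repetition_code_def intro!: carrier_vecI)

lemma code_power_double_repetition:
  "code_power double_repetition_code m
    = {w \<in> carrier_vec (2 * m). \<forall>k<m. w $ (2 * k) = w $ (2 * k + 1)}"
proof (induction m)
  case 0
  have "w = 0\<^sub>v 0" if "w \<in> carrier_vec 0" for w :: "bit vec"
    using that by (intro eq_vecI) auto
  then show ?case by auto
next
  case (Suc m)
  show ?case
  proof (intro Set.set_eqI iffI)
    fix w assume "w \<in> code_power double_repetition_code (Suc m)"
    then obtain u v where uv: "w = u @\<^sub>v v" "u \<in> carrier_vec 2" "u $ 0 = u $ 1"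
        "v \<in> carrier_vec (2 * m)" "\<And>k. k < m \<Longrightarrow> v $ (2 * k) = v $ (2 * k + 1)"
      by (auto simp: direct_sum_code_def mem_double_repetition_code Suc.IH)
    have "w $ (2 * k) = w $ (2 * k + 1)" if "k < Suc m" for k
      using uv that by (cases k) auto
    then show "w \<in> {w \<in> carrier_vec (2 * Suc m). \<forall>k<Suc m. w $ (2 * k) = w $ (2 * k + 1)}"
      using append_carrier_vec[OF uv(2,4)] uv(1) by simp
  next
    fix w :: "bit vec"
    assume w: "w \<in> {w \<in> carrier_vec (2 * Suc m). \<forall>k<Suc m. w $ (2 * k) = w $ (2 * k + 1)}"
    have "w = vec_first w 2 @\<^sub>v vec_last w (2 * m)"
      using w by (intro vec_first_last_append[symmetric]) auto
    moreover have "vec_first w 2 \<in> double_repetition_code"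
      using w by (auto simp: mem_double_repetition_code vec_first_def)
    moreover have "vec_last w (2 * m) \<in> code_power double_repetition_code m"
      using w by (auto simp: Suc.IH vec_last_def)
    ultimately show "w \<in> code_power double_repetition_code (Suc m)"
      by (auto simp: direct_sum_code_def)
  qed
qed

lemma sum_pairs: "(\<Sum>i<2 * m. h i) = (\<Sum>k<m. h (2 * k) + h (2 * k + 1))"
  for h :: "nat \<Rightarrow> 'a :: comm_monoid_add"
  by (induction m) (auto simp: add.assoc)

text \<open>
  Every coordinate has a unique twin, so the twins form a fixed-point-free involution,
  and a permutation moves twins next to each other. The permuted code then lies in the
  sum of double repetition codes. Equality holds because a word with equal entries at
  twins is orthogonal to \<open>C\<close>: its products with a codeword cancel in pairs.
\<close>
lemma equivalent_of_half_weight_shadow: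
  assumes C: "self_dual_code n C" and all: "\<And>s. s \<in> shadow n C \<Longrightarrow> 2 * wt s = n"
  shows "equivalent_codes n C (code_power double_repetition_code (n div 2))"
proof -
  define t where "t i = (SOME j. j < n \<and> j \<noteq> i \<and> unit_vec n i + unit_vec n j \<in> C)" for i
  have t: "t i < n \<and> t i \<noteq> i \<and> unit_vec n i + unit_vec n (t i) \<in> C" if "i < n" for i
    unfolding t_def using twin_exists[OF C all that] by (rule someI_ex)
  have tt: "t (t i) = i" if "i < n" for i
  proof (rule twin_unique[OF C])
    show "unit_vec n (t i) + unit_vec n i \<in> C"
      using t[OF that] by (simp add: comm_add_vec[of "unit_vec n (t i)" n])
  qed (use t[OF that] t[of "t i"] that in auto)
  obtain m :: nat and f where f: "bij_betw f {..<2 * m} {..<n}"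
      and ft: "\<And>k. k < m \<Longrightarrow> f (2 * k + 1) = t (f (2 * k))"
    using involution_enumeration[of "{..<n}" t] t tt by auto
  have n: "n = 2 * m" using bij_betw_same_card[OF f] by simp
  define p where "p i = (if i < n then f i else i)" for i
  have p: "p permutes {..<n}"
  proof (rule bij_imp_permutes)
    show "bij_betw p {..<n} {..<n}"
      using f n by (subst bij_betw_cong[of _ _ f]) (auto simp: p_def)
  qed (auto simp: p_def)
  have pn: "p i < n" if "i < n" for i
    using permutes_in_image[OF p, of i] that by simp
  have twin: "c $ p (2 * k) = c $ p (2 * k + 1)" if "c \<in> C" "k < m" for c k
  proof -
    have k: "2 * k < n" "2 * k + 1 < n" using that n by auto
    have "p (2 * k + 1) = t (p (2 * k))" using ft[OF that(2)] k by (simp add: p_def)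
    then show ?thesis using twin_coords_eq[OF C _ that(1)] t[OF pn[OF k(1)]] pn[OF k(1)] by metis
  qed
  have "permute_word n p ` C = code_power double_repetition_code m"
  proof (intro Set.set_eqI iffI)
    fix u assume "u \<in> permute_word n p ` C"
    then show "u \<in> code_power double_repetition_code m"
      using twin n by (auto simp: permute_word_def code_power_double_repetition)
  next
    fix u assume "u \<in> code_power double_repetition_code m"
    then have u: "u \<in> carrier_vec n" "\<And>k. k < m \<Longrightarrow> u $ (2 * k) = u $ (2 * k + 1)"
      using n by (auto simp: code_power_double_repetition)
    define w where "w = vec n (\<lambda>i. u $ inv_into UNIV p i)"
    have w: "w $ p i = u $ i" if "i < n" for i
      using pn[OF that] by (simp add: w_def permutes_inverses(2)[OF p])
    have "permute_word n p w = u"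
      using u w by (intro eq_vecI) (auto simp: permute_word_def)
    moreover have "c \<bullet> w = 0" if "c \<in> C" for c
    proof -
      have "c \<bullet> w = (\<Sum>i<n. c $ i * w $ i)"
        by (simp add: scalar_prod_def w_def lessThan_atLeast0)
      also have "\<dots> = (\<Sum>i<n. c $ p i * w $ p i)"
        by (rule sum.reindex_bij_betw[OF permutes_imp_bij[OF p], symmetric])
      also have "\<dots> = (\<Sum>i<2 * m. c $ p i * u $ i)"
        using w n by (intro sum.cong) auto
      also have "\<dots> = (\<Sum>k<m. c $ p (2 * k) * u $ (2 * k) + c $ p (2 * k + 1) * u $ (2 * k + 1))"
        by (rule sum_pairs)
      also have "\<dots> = (\<Sum>k<m. 0)"
        by (rule sum.cong) (simp_all add: twin[OF that] u(2))
      finally show ?thesis by simp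
    qed
    then have "w \<in> C" by (subst mem_code_iff[OF C]) (auto simp: w_def)
    ultimately show "u \<in> permute_word n p ` C" by blast
  qed
  then show ?thesis using p n by (auto simp: equivalent_codes_def)
qed

section \<open>The bound on the minimal weight\<close>

theorem mainTheorem5:
  fixes n :: nat and C :: "bit vec set"
  assumes "self_dual_code n C"
    and "\<not> equivalent_codes n C (code_power double_repetition_code (n div 2))"
  shows "(\<exists>w \<in> shadow n C. real (wt w) < real n / 2) \<and>
         real (min_weight (shadow n C)) \<le> (real n - 8) / 2"
proof -
  note C = assms(1)
  obtain s where s: "s \<in> shadow n C" "2 * wt s \<noteq> n"
    using equivalent_of_half_weight_shadow[OF C] assms(2) by blast
  let ?s' = "vec n (\<lambda>_. 1) + s"
  have sn: "s \<in> carrier_vec n" using s(1) by (rule shadow_carrier)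
  have "?s' \<in> shadow n C" using shadow_translate[OF C code_ones[OF C] s(1)] .
  moreover have "wt ?s' = n - wt s" "wt s \<le> n"
    using wt_complement[OF sn] by simp_all
  ultimately obtain w where w: "w \<in> shadow n C" "2 * wt w < n"
    using s by (cases "2 * wt s < n") auto
  obtain k where k: "n = 2 * k" using length_even[OF C] by (rule evenE)
  have "wt w mod 4 = k mod 4" "wt w < k"
    using shadow_wt_mod_4[OF C w(1)] w(2) k by simp_all
  then have "4 dvd k - wt w" "0 < k - wt w" by (simp_all flip: mod_eq_dvd_iff_nat)
  then have "4 \<le> k - wt w" by (rule dvd_imp_le)
  then have "2 * wt w + 8 \<le> n" using k by simp
  moreover have "min_weight (shadow n C) \<le> wt w"
    unfolding min_weight_def using w(1) shadow_finite by (intro Min_le) auto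
  ultimately have "2 * min_weight (shadow n C) + 8 \<le> n" by linarith
  then have "real (2 * min_weight (shadow n C) + 8) \<le> real n" by (simp only: of_nat_le_iff)
  then have "real (min_weight (shadow n C)) \<le> (real n - 8) / 2" by simp
  moreover have "real (wt w) < real n / 2" using w(2) by linarith
  ultimately show ?thesis using w(1) by blast
qed

end
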